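(* Let $N$ be a finite antilattice. Then the following implications and equivalences hold. (1) If $N$ is elementary, then $N$ is odd and simple. (2) If $N$ is odd and simple, then $N$ is odd; and if $N$ is odd and simple, then $N$ is simple. (3) The following three conditions are equivalent: $N$ is odd; the even graph of $N$ is empty (has no edges); $N$ is Latin. (4) If $N$ is Latin, then $N$ is semimagic. (5) If $N$ is semimagic, then $N$ is square. (6) If $N$ is simple, then $N$ is irreducible.
   Context: An antilattice $(N,\land,\lor)$ is a set $N$ with two associative idempotent binary operations satisfying $x\land y\land x=x$ and $x\lor y\lor x=x$ for all $x,y$ (so both reducts $(N,\land)$ and $(N,\lor)$ are rectangular bands). A subantilattice is a nonempty subset closed under both operations; it is trivial if it has one element and proper if it is a proper subset. $N$ is elementary if it has no proper nontrivial subantilattices. $N$ is odd if it has no subantilattice with exactly $2$ elements. $N$ is simple if its only congruences (equivalence relations compatible with both operations) are the equality relation and the universal relation. $N$ is irreducible if it is not isomorphic to a direct product of two antilattices each having more than one element. The even graph of $N$ is the graph with vertex set $N$ in which distinct $a,b$ are adjacent if and only if $\{a,b\}$ is a subantilattice. Generating matrices: for a finite rectangular band $(B,\cdot)$ of order $n$ there are $p,q\geq 1$ with $pq=n$ and a $p\times q$ matrix $G$ in which each element of $B$ occurs exactly once, such that $G_{ij}\cdot G_{kl}=G_{il}$ for all $i,j,k,l$; $p,q$ are uniquely determined and $G$ is unique up to permuting rows and permuting columns. A finite antilattice $N$ is determined by a pair of generating matrices: $M$ (meet matrix, $p\times q$) for $(N,\land)$ and $J$ (join matrix, $r\times s$)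 for $(N,\lor)$, with $pq=rs=|N|$. $N$ is square if $p=q=r=s$. When the elements of $N$ are labelled by $1,\dots,pq$, $M$ is in normal form if $M_{ij}=(i-1)q+j$ for all $i,j$; this can always be achieved by relabelling the elements. $N$ is Latin if, after a relabelling for which $M$ is in normal form, and after replacing each element $(i-1)q+j$ by the pair $(i,j)$, the matrices $J_1$ and $J_2$ of first and second components of the entries of $J$ are orthogonal Latin squares. (A Latin square is an $m\times m$ array filled with $m$ different symbols, each occurring exactly once in each row and in each column; two Latin squares of the same size are orthogonal if, when they are superimposed, the ordered pairs in the entries are all distinct.) A semimagic square is an $m\times m$ array consisting of distinct entries from $\{1,\dots,m^2\}$ such that the sums of the numbers in each row and in each column are all equal. $N$ is semimagic if, for some labelling of its elements by $1,\dots,m^2$, it has a generating matrix pair $(M,J)$ where $M$ is the $m\times m$ matrix in normal form and $J$ is an $m\times m$ semimagic square.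
   Formalization: In (1), "elementary implies odd" is stated only for N not having exactly two elements, since every two-element antilattice is elementary but is itself a two-element subantilattice, hence not odd; "elementary implies simple" is kept for all N. *)

theory Defs
  imports Main "Graph_Theory.Pair_Digraph"
begin

section \<open>Antilattices\<close>

record 'a antilat =
  carrier :: "'a set"
  meet :: "'a \<Rightarrow> 'a \<Rightarrow> 'a"
  join :: "'a \<Rightarrow> 'a \<Rightarrow> 'a"

definition rectangular_band :: "'a set \<Rightarrow> ('a \<Rightarrow> 'a \<Rightarrow> 'a) \<Rightarrow> bool" where
  "rectangular_band B f \<longleftrightarrow>
     (\<forall>x\<in>B. \<forall>y\<in>B. f x y \<in> B) \<and>
     (\<forall>x\<in>B. \<forall>y\<in>B. \<forall>z\<in>B. f (f x y) z = f x (f y z)) \<and>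
     (\<forall>x\<in>B. f x x = x) \<and>
     (\<forall>x\<in>B. \<forall>y\<in>B. f (f x y) x = x)"

text \<open>As usual for algebras, the underlying set is nonempty.\<close>

definition antilattice :: "'a antilat \<Rightarrow> bool" where
  "antilattice N \<longleftrightarrow>
     carrier N \<noteq> {} \<and>
     rectangular_band (carrier N) (meet N) \<and>
     rectangular_band (carrier N) (join N)"

definition subantilattice :: "'a antilat \<Rightarrow> 'a set \<Rightarrow> bool" where
  "subantilattice N S \<longleftrightarrow>
     S \<noteq> {} \<and> S \<subseteq> carrier N \<and>
     (\<forall>x\<in>S. \<forall>y\<in>S. meet N x y \<in> S \<and> join N x y \<in> S)"

definition is_elementary :: "'a antilat \<Rightarrow> bool" where
  "is_elementary N \<longleftrightarrow>
     \<not> (\<exists>S. subantilattice N S \<and> S \<noteq> carrier N \<and> card S \<noteq> 1)"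

definition is_odd :: "'a antilat \<Rightarrow> bool" where
  "is_odd N \<longleftrightarrow> \<not> (\<exists>S. subantilattice N S \<and> card S = 2)"

definition congruence :: "'a antilat \<Rightarrow> 'a rel \<Rightarrow> bool" where
  "congruence N R \<longleftrightarrow>
     equiv (carrier N) R \<and>
     (\<forall>a b c d. (a, b) \<in> R \<longrightarrow> (c, d) \<in> R \<longrightarrow>
        (meet N a c, meet N b d) \<in> R \<and> (join N a c, join N b d) \<in> R)"

definition is_simple :: "'a antilat \<Rightarrow> bool" where
  "is_simple N \<longleftrightarrow>
     (\<forall>R. congruence N R \<longrightarrow> R = Id_on (carrier N) \<or> R = carrier N \<times> carrier N)"

definition direct_product :: "'a antilat \<Rightarrow> 'b antilat \<Rightarrow> ('a \<times> 'b) antilat" where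
  "direct_product A B =
     \<lparr> carrier = carrier A \<times> carrier B,
       meet = (\<lambda>(a, b) (a', b'). (meet A a a', meet B b b')),
       join = (\<lambda>(a, b) (a', b'). (join A a a', join B b b')) \<rparr>"

definition isomorphic :: "'a antilat \<Rightarrow> 'b antilat \<Rightarrow> bool" where
  "isomorphic N N' \<longleftrightarrow>
     (\<exists>h. bij_betw h (carrier N) (carrier N') \<and>
          (\<forall>x\<in>carrier N. \<forall>y\<in>carrier N.
             h (meet N x y) = meet N' (h x) (h y) \<and>
             h (join N x y) = join N' (h x) (h y)))"

definition more_than_one :: "'a antilat \<Rightarrow> bool" where
  "more_than_one A \<longleftrightarrow> (\<exists>x\<in>carrier A. \<exists>y\<in>carrier A. x \<noteq> y)"

text \<open>
  The factors range over antilattices with elements in the element type of \<open>N\<close>, since a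
  definition cannot quantify over types.  This loses nothing: by
  \<open>not_irreducible_if_product\<close> below, a decomposition with factors over any other types
  also makes \<open>N\<close> reducible.
\<close>

definition is_irreducible :: "'a antilat \<Rightarrow> bool" where
  "is_irreducible N \<longleftrightarrow>
     \<not> (\<exists>(A :: 'a antilat) (B :: 'a antilat). antilattice A \<and> antilattice B \<and>
           more_than_one A \<and> more_than_one B \<and> isomorphic N (direct_product A B))"

text \<open>
  Simple graphs are symmetric, loopfree arc relations; see \<open>pair_graph_even_graph\<close> below.
\<close>

definition even_graph :: "'a antilat \<Rightarrow> 'a pair_pre_digraph" where
  "even_graph N =
     \<lparr> pverts = carrier N,
       parcs = {(a, b). a \<in> carrier N \<and> b \<in> carrier N \<and> a \<noteq> b \<and> subantilattice N {a, b}} \<rparr>"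


section \<open>Generating matrices\<close>

text \<open>
  A matrix with \<open>p\<close> rows and \<open>q\<close> columns is a function of two indices; only its values
  at indices in \<open>{1..p} \<times> {1..q}\<close> matter.
\<close>

definition generating_matrix ::
  "'a set \<Rightarrow> ('a \<Rightarrow> 'a \<Rightarrow> 'a) \<Rightarrow> nat \<Rightarrow> nat \<Rightarrow> (nat \<Rightarrow> nat \<Rightarrow> 'a) \<Rightarrow> bool" where
  "generating_matrix B f p q G \<longleftrightarrow>
     1 \<le> p \<and> 1 \<le> q \<and>
     bij_betw (\<lambda>(i, j). G i j) ({1..p} \<times> {1..q}) B \<and>
     (\<forall>i\<in>{1..p}. \<forall>j\<in>{1..q}. \<forall>k\<in>{1..p}. \<forall>l\<in>{1..q}. f (G i j) (G k l) = G i l)"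

definition generating_pair ::
  "'a antilat \<Rightarrow> nat \<Rightarrow> nat \<Rightarrow> (nat \<Rightarrow> nat \<Rightarrow> 'a) \<Rightarrow> nat \<Rightarrow> nat \<Rightarrow> (nat \<Rightarrow> nat \<Rightarrow> 'a) \<Rightarrow> bool" where
  "generating_pair N p q M r s J \<longleftrightarrow>
     generating_matrix (carrier N) (meet N) p q M \<and>
     generating_matrix (carrier N) (join N) r s J"

definition is_square :: "'a antilat \<Rightarrow> bool" where
  "is_square N \<longleftrightarrow>
     (\<exists>p q r s M J. generating_pair N p q M r s J \<and> p = q \<and> q = r \<and> r = s)"

text \<open>
  Relabelling the elements of \<open>N\<close> by \<open>1, \<dots>, n\<close> is represented by a bijection \<open>lab\<close>;
  the relabelled version of a matrix \<open>G\<close> is then \<open>\<lambda>i j. lab (G i j)\<close>.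
\<close>

definition labelling :: "'a antilat \<Rightarrow> nat \<Rightarrow> ('a \<Rightarrow> nat) \<Rightarrow> bool" where
  "labelling N n lab \<longleftrightarrow> bij_betw lab (carrier N) {1..n}"

definition normal_form :: "nat \<Rightarrow> nat \<Rightarrow> (nat \<Rightarrow> nat \<Rightarrow> nat) \<Rightarrow> bool" where
  "normal_form p q M \<longleftrightarrow> (\<forall>i\<in>{1..p}. \<forall>j\<in>{1..q}. M i j = (i - 1) * q + j)"

text \<open>
  The components of the pair \<open>(i, j)\<close> that replaces the label \<open>(i - 1) * q + j\<close>;
  see \<open>component_label\<close> below.
\<close>

definition first_component :: "nat \<Rightarrow> nat \<Rightarrow> nat" where
  "first_component q x = (x - 1) div q + 1"

definition second_component :: "nat \<Rightarrow> nat \<Rightarrow> nat" where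
  "second_component q x = (x - 1) mod q + 1"

definition latin_square :: "nat \<Rightarrow> (nat \<Rightarrow> nat \<Rightarrow> 'b) \<Rightarrow> bool" where
  "latin_square m L \<longleftrightarrow>
     (\<exists>S. finite S \<and> card S = m \<and>
        (\<forall>i\<in>{1..m}. \<forall>j\<in>{1..m}. L i j \<in> S) \<and>
        (\<forall>x\<in>S. \<forall>i\<in>{1..m}. \<exists>!j. j \<in> {1..m} \<and> L i j = x) \<and>
        (\<forall>x\<in>S. \<forall>j\<in>{1..m}. \<exists>!i. i \<in> {1..m} \<and> L i j = x))"

definition orthogonal_latin_squares ::
  "nat \<Rightarrow> (nat \<Rightarrow> nat \<Rightarrow> 'b) \<Rightarrow> (nat \<Rightarrow> nat \<Rightarrow> 'c) \<Rightarrow> bool" where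
  "orthogonal_latin_squares m L K \<longleftrightarrow>
     latin_square m L \<and> latin_square m K \<and>
     inj_on (\<lambda>(i, j). (L i j, K i j)) ({1..m} \<times> {1..m})"

definition is_latin :: "'a antilat \<Rightarrow> bool" where
  "is_latin N \<longleftrightarrow>
     (\<exists>p q m M J lab.
        generating_pair N p q M m m J \<and>
        labelling N (p * q) lab \<and> normal_form p q (\<lambda>i j. lab (M i j)) \<and>
        orthogonal_latin_squares m
          (\<lambda>i j. first_component q (lab (J i j)))
          (\<lambda>i j. second_component q (lab (J i j))))"

definition semimagic_square :: "nat \<Rightarrow> (nat \<Rightarrow> nat \<Rightarrow> nat) \<Rightarrow> bool" where
  "semimagic_square m A \<longleftrightarrow>
     (\<forall>i\<in>{1..m}. \<forall>j\<in>{1..m}. A i j \<in> {1..m\<^sup>2}) \<and>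
     inj_on (\<lambda>(i, j). A i j) ({1..m} \<times> {1..m}) \<and>
     (\<exists>c. (\<forall>i\<in>{1..m}. (\<Sum>j=1..m. A i j) = c) \<and> (\<forall>j\<in>{1..m}. (\<Sum>i=1..m. A i j) = c))"

definition is_semimagic :: "'a antilat \<Rightarrow> bool" where
  "is_semimagic N \<longleftrightarrow>
     (\<exists>m M J lab.
        generating_pair N m m M m m J \<and>
        labelling N (m\<^sup>2) lab \<and> normal_form m m (\<lambda>i j. lab (M i j)) \<and>
        semimagic_square m (\<lambda>i j. lab (J i j)))"


section \<open>Adequacy of the encodings\<close>

lemma component_label:
  assumes "1 \<le> i" "j \<in> {1..q}"
  shows "first_component q ((i - 1) * q + j) = i"
    and "second_component q ((i - 1) * q + j) = j"
proof -
  have eq: "(i - 1) * q + j - 1 = (j - 1) + (i - 1) * q" using assms by simp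
  have lt: "j - 1 < q" "0 < q" using assms by auto
  have "((j - 1) + (i - 1) * q) div q = i - 1" "((j - 1) + (i - 1) * q) mod q = j - 1"
    using lt by (simp_all only: div_mult_self1 mod_mult_self1 div_less mod_less)
  then show "first_component q ((i - 1) * q + j) = i"
    and "second_component q ((i - 1) * q + j) = j"
    using assms unfolding first_component_def second_component_def eq by (simp_all only:) simp_all
qed

lemma pair_graph_even_graph:
  assumes "finite (carrier N)"
  shows "pair_graph (even_graph N)"
proof
  show "finite (pverts (even_graph N))"
    using assms by (simp add: even_graph_def)
  show "finite (parcs (even_graph N))"
    by (rule finite_subset[of _ "carrier N \<times> carrier N"]) (auto simp: even_graph_def assms)
  show "symmetric (with_proj (even_graph N))"
    by (auto simp: symmetric_def even_graph_def insert_commute intro!: symI)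
qed (auto simp: even_graph_def)

text \<open>
  A two-element antilattice is elementary but not odd, so an elementary antilattice can only be
  expected to be odd if it does not have exactly two elements.
\<close>

lemma two_elements_elementary_not_odd:
  assumes "antilattice N" "card (carrier N) = 2"
  shows "is_elementary N" "\<not> is_odd N"
proof -
  have fin: "finite (carrier N)" using assms(2) by (metis card.infinite zero_neq_numeral)
  have "card S = 1 \<or> S = carrier N" if "subantilattice N S" for S
  proof -
    have S: "S \<subseteq> carrier N" "S \<noteq> {}" using that by (auto simp: subantilattice_def)
    then have "0 < card S" "card S \<le> 2" using fin assms(2)
      by (metis card_gt_0_iff finite_subset, metis card_mono)
    then consider "card S = 1" | "card S = 2" by linarith
    then show ?thesis using S fin assms(2) by cases (auto simp: card_subset_eq)
  qed
  then show "is_elementary N" by (auto simp: is_elementary_def)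
  have "subantilattice N (carrier N)"
    using assms(1) by (auto simp: subantilattice_def antilattice_def rectangular_band_def)
  then show "\<not> is_odd N" using assms(2) by (auto simp: is_odd_def)
qed

definition transport :: "('a \<Rightarrow> 'b) \<Rightarrow> 'a antilat \<Rightarrow> 'b antilat" where
  "transport h A =
     \<lparr> carrier = h ` carrier A,
       meet = (\<lambda>x y. h (meet A (inv_into (carrier A) h x) (inv_into (carrier A) h y))),
       join = (\<lambda>x y. h (join A (inv_into (carrier A) h x) (inv_into (carrier A) h y))) \<rparr>"

lemma transport_simps:
  assumes "inj_on h (carrier A)"
  shows "carrier (transport h A) = h ` carrier A"
    and "\<lbrakk>x \<in> carrier A; y \<in> carrier A\<rbrakk> \<Longrightarrow> meet (transport h A) (h x) (h y) = h (meet A x y)"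
    and "\<lbrakk>x \<in> carrier A; y \<in> carrier A\<rbrakk> \<Longrightarrow> join (transport h A) (h x) (h y) = h (join A x y)"
  using assms by (simp_all add: transport_def)

lemma antilattice_transport:
  assumes "antilattice A" "inj_on h (carrier A)"
  shows "antilattice (transport h A)"
  using assms(1)
  by (auto simp: antilattice_def rectangular_band_def transport_simps[OF assms(2)])

lemma not_irreducible_if_product:
  fixes N :: "'a antilat" and A :: "'b antilat" and B :: "'c antilat"
  assumes "antilattice A" "antilattice B" "more_than_one A" "more_than_one B"
    and "isomorphic N (direct_product A B)"
  shows "\<not> is_irreducible N"
proof -
  obtain h where h: "bij_betw h (carrier N) (carrier A \<times> carrier B)"
    and hom: "\<And>x y. \<lbrakk>x \<in> carrier N; y \<in> carrier N\<rbrakk> \<Longrightarrow>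
        h (meet N x y) = meet (direct_product A B) (h x) (h y) \<and>
        h (join N x y) = join (direct_product A B) (h x) (h y)"
    using assms(5) by (auto simp: isomorphic_def direct_product_def)
  obtain a0 b0 where ab: "a0 \<in> carrier A" "b0 \<in> carrier B"
    using assms(3,4) by (auto simp: more_than_one_def)
  define g where "g = inv_into (carrier N) h"
  have g: "inj_on g (carrier A \<times> carrier B)"
    using bij_betw_inv_into[OF h] by (simp add: g_def bij_betw_def)
  define u where "u a = g (a, b0)" for a
  define v where "v b = g (a0, b)" for b
  have u: "inj_on u (carrier A)" and v: "inj_on v (carrier B)"
    using g ab by (auto simp: inj_on_def u_def v_def)
  let ?A = "transport u A" and ?B = "transport v B"
  let ?k = "\<lambda>x. (u (fst (h x)), v (snd (h x)))"
  have hN: "h x \<in> carrier A \<times> carrier B" if "x \<in> carrier N" for x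
    using h that by (auto simp: bij_betw_def)
  have "bij_betw (map_prod u v) (carrier A \<times> carrier B) (u ` carrier A \<times> v ` carrier B)"
    using u v by (auto simp: bij_betw_def intro: map_prod_inj_on)
  from bij_betw_trans[OF h this]
  have bij: "bij_betw ?k (carrier N) (carrier (direct_product ?A ?B))"
    by (simp add: direct_product_def transport_simps(1)[OF u] transport_simps(1)[OF v]
        comp_def map_prod_def case_prod_unfold)
  have hm: "?k (meet N x y) = meet (direct_product ?A ?B) (?k x) (?k y) \<and>
        ?k (join N x y) = join (direct_product ?A ?B) (?k x) (?k y)"
    if "x \<in> carrier N" "y \<in> carrier N" for x y
    using hom[OF that] hN[OF that(1)] hN[OF that(2)]
    by (auto simp: direct_product_def case_prod_unfold transport_simps[OF u] transport_simps[OF v]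
        mem_Times_iff)
  have "isomorphic N (direct_product ?A ?B)"
    unfolding isomorphic_def using bij hm by blast
  moreover have "antilattice ?A" "antilattice ?B"
    using antilattice_transport assms(1,2) u v by blast+
  moreover have "more_than_one ?A"
    using assms(3) u by (auto simp: more_than_one_def transport_simps(1)[OF u] inj_on_def)
  moreover have "more_than_one ?B"
    using assms(4) v by (auto simp: more_than_one_def transport_simps(1)[OF v] inj_on_def)
  ultimately show ?thesis unfolding is_irreducible_def by blast
qed

end

theory Submission
  imports Defs
begin

text \<open>
  A pair of elements is a subband of a rectangular band iff the two elements lie in a common row or
  column of the generating matrix.  Hence \<open>N\<close> is odd iff every line of the meet matrix meets every
  line of the join matrix in at most one element.  Comparing the lengths of the lines, this forces
  both matrices to be square of the same order; reading off the meet coordinates of the entries of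
  the join matrix then gives two orthogonal Latin squares, and conversely.  In a Latin pair the
  labels \<open>(i - 1) * m + j\<close> along a line of the join matrix run over all \<open>i\<close> and all \<open>j\<close> exactly
  once, so the line sums agree.  The remaining implications hold because the classes of a congruence
  are subantilattices and because the kernel of a projection is a congruence.
\<close>

section \<open>Coordinates in a rectangular band\<close>

text \<open>Since \<open>x z x = x\<close>, the first factor may be replaced by
  \<open>x z x\<close>. After regrouping, \<open>z (x y) z\<close> collapses to \<open>z\<close>,
  and \<open>y\<close> disappears.\<close>

lemma rectangular_band_middle:
  assumes "rectangular_band B f" "x \<in> B" "y \<in> B" "z \<in> B"
  shows "f (f x y) z = f x z"
proof -
  have cl: "f a b \<in> B" and as: "f (f a b) c = f a (f b c)" and id: "f (f a b) a = a"
    if "a \<in> B" "b \<in> B" "c \<in> B" for a b c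
    using assms(1) that unfolding rectangular_band_def by blast+
  have "f (f x y) z = f (f (f (f x z) x) y) z"
    using id[of x z z] assms by simp
  also have "\<dots> = f x (f (f z (f x y)) z)"
    using assms cl as by simp
  also have "\<dots> = f x z"
    using id[of z "f x y" z] assms cl by simp
  finally show ?thesis .
qed

text \<open>Fix \<open>e\<close>. The products \<open>x e\<close> form a left zero band
  \<open>R\<close>, the products \<open>e x\<close> a right zero band \<open>C\<close>, and
  \<open>B\<close> is their product: \<open>(a, b)\<close> goes to \<open>a b\<close>, with inverse
  sending \<open>x\<close> to \<open>(x e, e x)\<close>. Elements of \<open>R\<close> serve as row
  indices, elements of \<open>C\<close> as column indices.\<close>

lemma generating_matrix_exists:
  assumes B: "rectangular_band B f" "B \<noteq> {}" "finite B"
  shows "\<exists>p q G. generating_matrix B f p q G"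
proof -
  obtain e where e: "e \<in> B" using B(2) by blast
  have cl: "f a b \<in> B" if "a \<in> B" "b \<in> B" for a b
    using B(1) that unfolding rectangular_band_def by blast
  have as: "f (f a b) c = f a (f b c)" if "a \<in> B" "b \<in> B" "c \<in> B" for a b c
    using B(1) that unfolding rectangular_band_def by blast
  have id: "f a a = a" if "a \<in> B" for a
    using B(1) that unfolding rectangular_band_def by blast
  have mid: "f a (f b c) = f a c" if "a \<in> B" "b \<in> B" "c \<in> B" for a b c
    using rectangular_band_middle[OF B(1) that] as[OF that] by simp
  define R where "R = (\<lambda>x. f x e) ` B"
  define C where "C = (\<lambda>x. f e x) ` B"
  have R: "R \<subseteq> B" "finite R" "R \<noteq> {}" and C: "C \<subseteq> B" "finite C" "C \<noteq> {}"
    using e cl B by (auto simp: R_def C_def)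
  obtain \<alpha> where \<alpha>: "bij_betw \<alpha> {1..card R} R"
    using ex_bij_betw_nat_finite_1[OF R(2)] by blast
  obtain \<beta> where \<beta>: "bij_betw \<beta> {1..card C} C"
    using ex_bij_betw_nat_finite_1[OF C(2)] by blast
  have Re: "f a e = a" if "a \<in> R" for a
    using that as mid id e by (auto simp: R_def)
  have Ce: "f e b = b" if "b \<in> C" for b
    using that mid e by (auto simp: C_def)
  \<comment> \<open>Both factors are recovered from the product, which gives injectivity of the
    multiplication map.\<close>
  have rec: "f (f a b) e = a" "f e (f a b) = b" if "a \<in> R" "b \<in> C" for a b
    using that as mid e Re Ce R C by (auto simp: subset_iff)
  have "bij_betw (\<lambda>(a, b). f a b) (R \<times> C) B"
    unfolding bij_betw_def
  proof
    show "inj_on (\<lambda>(a, b). f a b) (R \<times> C)"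
    proof (rule inj_onI, clarify)
      fix a b a' b' assume "a \<in> R" "b \<in> C" "a' \<in> R" "b' \<in> C" "f a b = f a' b'"
      then show "a = a' \<and> b = b'" using rec[of a b] rec[of a' b'] by simp
    qed
    have "x \<in> (\<lambda>(a, b). f a b) ` (R \<times> C)" if "x \<in> B" for x
    proof
      show "x = (\<lambda>(a, b). f a b) (f x e, f e x)"
        using that e as mid cl id by simp
      show "(f x e, f e x) \<in> R \<times> C" using that by (auto simp: R_def C_def)
    qed
    then show "(\<lambda>(a, b). f a b) ` (R \<times> C) = B"
      using R(1) C(1) cl by (intro subset_antisym) (auto simp: subset_iff)
  qed
  moreover have "bij_betw (map_prod \<alpha> \<beta>) ({1..card R} \<times> {1..card C}) (R \<times> C)"
    using \<alpha> \<beta> by (rule bij_betw_map_prod)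
  ultimately have "bij_betw ((\<lambda>(a, b). f a b) \<circ> map_prod \<alpha> \<beta>) ({1..card R} \<times> {1..card C}) B"
    by (metis bij_betw_trans)
  moreover have "(\<lambda>(a, b). f a b) \<circ> map_prod \<alpha> \<beta> = (\<lambda>(i, j). f (\<alpha> i) (\<beta> j))"
    by auto
  ultimately have bij: "bij_betw (\<lambda>(i, j). f (\<alpha> i) (\<beta> j)) ({1..card R} \<times> {1..card C}) B"
    by simp
  have "\<alpha> i \<in> B" if "i \<in> {1..card R}" for i using \<alpha> R that by (auto simp: bij_betw_def)
  moreover have "\<beta> i \<in> B" if "i \<in> {1..card C}" for i using \<beta> C that by (auto simp: bij_betw_def)
  ultimately have "generating_matrix B f (card R) (card C) (\<lambda>i j. f (\<alpha> i) (\<beta> j))"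
    unfolding generating_matrix_def
    using bij R C by (auto simp: as mid cl Suc_le_eq card_gt_0_iff)
  then show ?thesis by blast
qed

section \<open>Row and column coordinates, collinearity\<close>

definition row_of :: "nat \<Rightarrow> nat \<Rightarrow> (nat \<Rightarrow> nat \<Rightarrow> 'a) \<Rightarrow> 'a \<Rightarrow> nat" where
  "row_of p q G x = fst (inv_into ({1..p} \<times> {1..q}) (\<lambda>(i, j). G i j) x)"

definition col_of :: "nat \<Rightarrow> nat \<Rightarrow> (nat \<Rightarrow> nat \<Rightarrow> 'a) \<Rightarrow> 'a \<Rightarrow> nat" where
  "col_of p q G x = snd (inv_into ({1..p} \<times> {1..q}) (\<lambda>(i, j). G i j) x)"

text \<open>The relation is reflexive, so oddness will read: collinear in both matrices implies
  equal.\<close>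

definition collinear :: "nat \<Rightarrow> nat \<Rightarrow> (nat \<Rightarrow> nat \<Rightarrow> 'a) \<Rightarrow> 'a \<Rightarrow> 'a \<Rightarrow> bool" where
  "collinear p q G x y \<longleftrightarrow> row_of p q G x = row_of p q G y \<or> col_of p q G x = col_of p q G y"

lemma matrix_entry:
  assumes "generating_matrix B f p q G" "i \<in> {1..p}" "j \<in> {1..q}"
  shows "G i j \<in> B" "row_of p q G (G i j) = i" "col_of p q G (G i j) = j"
proof -
  have bij: "bij_betw (\<lambda>(i, j). G i j) ({1..p} \<times> {1..q}) B"
    using assms(1) by (simp add: generating_matrix_def)
  show "G i j \<in> B" using bij assms by (auto simp: bij_betw_def)
  have "inv_into ({1..p} \<times> {1..q}) (\<lambda>(i, j). G i j) (G i j) = (i, j)"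
    using inv_into_f_f[OF bij_betw_imp_inj_on[OF bij], of "(i, j)"] assms by simp
  then show "row_of p q G (G i j) = i" "col_of p q G (G i j) = j"
    by (simp_all add: row_of_def col_of_def)
qed

lemma matrix_coordinates:
  assumes "generating_matrix B f p q G" "x \<in> B"
  shows "row_of p q G x \<in> {1..p}" "col_of p q G x \<in> {1..q}"
    "G (row_of p q G x) (col_of p q G x) = x"
proof -
  have "x \<in> (\<lambda>(i, j). G i j) ` ({1..p} \<times> {1..q})"
    using assms by (simp add: generating_matrix_def bij_betw_def)
  then obtain i j where "i \<in> {1..p}" "j \<in> {1..q}" "x = G i j" by auto
  then show "row_of p q G x \<in> {1..p}" "col_of p q G x \<in> {1..q}"
    "G (row_of p q G x) (col_of p q G x) = x"
    using matrix_entry[OF assms(1)] by auto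
qed

lemma band_product_coordinates:
  assumes "generating_matrix B f p q G" "x \<in> B" "y \<in> B"
  shows "f x y = G (row_of p q G x) (col_of p q G y)"
  using assms matrix_coordinates[OF assms(1,2)] matrix_coordinates[OF assms(1,3)]
  unfolding generating_matrix_def by metis

text \<open>The product \<open>f x y\<close> sits in the row of \<open>x\<close> and the column of
  \<open>y\<close>. Hence it is \<open>x\<close> exactly when the columns agree and \<open>y\<close>
  exactly when the rows agree.\<close>

lemma pair_subband_iff_collinear:
  assumes G: "generating_matrix B f p q G" and x: "x \<in> B" and y: "y \<in> B"
  shows "(\<forall>u\<in>{x, y}. \<forall>v\<in>{x, y}. f u v \<in> {x, y}) \<longleftrightarrow> collinear p q G x y"
proof -
  note cx = matrix_coordinates[OF G x] and cy = matrix_coordinates[OF G y]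
  have sq: "f x x = x" "f y y = y"
    using band_product_coordinates[OF G] x y cx cy by auto
  have xy: "row_of p q G (f x y) = row_of p q G x" "col_of p q G (f x y) = col_of p q G y"
    using band_product_coordinates[OF G x y] matrix_entry[OF G] cx cy by auto
  show ?thesis
  proof
    assume "\<forall>u\<in>{x, y}. \<forall>v\<in>{x, y}. f u v \<in> {x, y}"
    then have "f x y = x \<or> f x y = y" by blast
    then show "collinear p q G x y" using xy by (auto simp: collinear_def)
  next
    assume "collinear p q G x y"
    then show "\<forall>u\<in>{x, y}. \<forall>v\<in>{x, y}. f u v \<in> {x, y}"
      using sq cx cy band_product_coordinates[OF G x y] band_product_coordinates[OF G y x]
      by (auto simp: collinear_def)
  qed
qed

text \<open>By \<open>sep\<close>, the entries of the first row of \<open>G\<close> lie in different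
  rows and in different columns of \<open>H\<close>, which bounds \<open>q\<close> by
  \<open>r\<close> and \<open>s\<close>. The first column of \<open>G\<close> bounds
  \<open>p\<close> in the same way.\<close>

lemma matrix_lines_le:
  assumes G: "generating_matrix B f p q G" and H: "generating_matrix B g r s H"
    and sep: "\<And>x y. \<lbrakk>x \<in> B; y \<in> B; collinear p q G x y; collinear r s H x y\<rbrakk> \<Longrightarrow> x = y"
  shows "q \<le> r" "q \<le> s" "p \<le> r" "p \<le> s"
proof -
  have one: "1 \<in> {1..p}" "1 \<in> {1..q}" using G by (auto simp: generating_matrix_def)
  note e = matrix_entry[OF G]
  have sub: "row_of r s H (G i j) \<in> {1..r}" "col_of r s H (G i j) \<in> {1..s}"
    if "i \<in> {1..p}" "j \<in> {1..q}" for i j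
    using matrix_coordinates[OF H] e[OF that] by auto
  have rows: "j = j'" if "j \<in> {1..q}" "j' \<in> {1..q}" "collinear r s H (G 1 j) (G 1 j')" for j j'
  proof -
    note a = e[OF one(1) that(1)] and b = e[OF one(1) that(2)]
    have "collinear p q G (G 1 j) (G 1 j')" using a b by (simp add: collinear_def)
    then have "G 1 j = G 1 j'" by (rule sep[OF a(1) b(1) _ that(3)])
    then show ?thesis using a(3) b(3) by simp
  qed
  have cols: "i = i'" if "i \<in> {1..p}" "i' \<in> {1..p}" "collinear r s H (G i 1) (G i' 1)" for i i'
  proof -
    note a = e[OF that(1) one(2)] and b = e[OF that(2) one(2)]
    have "collinear p q G (G i 1) (G i' 1)" using a b by (simp add: collinear_def)
    then have "G i 1 = G i' 1" by (rule sep[OF a(1) b(1) _ that(3)])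
    then show ?thesis using a(2) b(2) by simp
  qed
  have "inj_on (\<lambda>j. row_of r s H (G 1 j)) {1..q}" "inj_on (\<lambda>j. col_of r s H (G 1 j)) {1..q}"
    using rows by (auto simp: inj_on_def collinear_def)
  from this[THEN card_inj_on_le, of "{1..r}"] this[THEN card_inj_on_le, of "{1..s}"]
  show "q \<le> r" "q \<le> s" using sub one by (auto simp: image_subset_iff)
  have "inj_on (\<lambda>i. row_of r s H (G i 1)) {1..p}" "inj_on (\<lambda>i. col_of r s H (G i 1)) {1..p}"
    using cols by (auto simp: inj_on_def collinear_def)
  from this[THEN card_inj_on_le, of "{1..r}"] this[THEN card_inj_on_le, of "{1..s}"]
  show "p \<le> r" "p \<le> s" using sub one by (auto simp: image_subset_iff)
qed

section \<open>Labels in normal form\<close>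

text \<open>Bridge from label arithmetic to geometry: decoding a label by \<open>div\<close> and
  \<open>mod\<close> returns the position of the element in the matrix.\<close>

lemma normal_form_components:
  assumes "generating_matrix B f p q G" "normal_form p q (\<lambda>i j. lab (G i j))" "x \<in> B"
  shows "first_component q (lab x) = row_of p q G x" "second_component q (lab x) = col_of p q G x"
proof -
  note c = matrix_coordinates[OF assms(1,3)]
  have "lab x = (row_of p q G x - 1) * q + col_of p q G x"
    using assms(2) c unfolding normal_form_def by metis
  then show "first_component q (lab x) = row_of p q G x"
    "second_component q (lab x) = col_of p q G x"
    using component_label c by auto
qed

text \<open>The label is computed from the coordinates. It is injective because decoding recovers
  them, and it maps into a set of the same size as the carrier, so it is onto.\<close>

lemma normal_form_labelling_exists:
  assumes G: "generating_matrix (carrier N) f p q G"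
  shows "\<exists>lab. labelling N (p * q) lab \<and> normal_form p q (\<lambda>i j. lab (G i j))"
proof (intro exI conjI)
  let ?lab = "\<lambda>x. (row_of p q G x - 1) * q + col_of p q G x"
  show nf: "normal_form p q (\<lambda>i j. ?lab (G i j))"
    using matrix_entry[OF G] by (auto simp: normal_form_def)
  have "inj_on ?lab (carrier N)"
  proof (rule inj_onI)
    fix x y assume xy: "x \<in> carrier N" "y \<in> carrier N" "?lab x = ?lab y"
    then have "row_of p q G x = row_of p q G y" "col_of p q G x = col_of p q G y"
      using normal_form_components[OF G nf] by metis+
    then show "x = y" using matrix_coordinates[OF G] xy by metis
  qed
  moreover have "?lab ` carrier N \<subseteq> {1..p * q}"
  proof
    fix n assume "n \<in> ?lab ` carrier N"
    then obtain x where x: "x \<in> carrier N" "n = ?lab x" by blast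
    note c = matrix_coordinates[OF G x(1)]
    have "(row_of p q G x - 1) * q \<le> (p - 1) * q" using c by auto
    moreover have "(p - 1) * q + q = p * q" using c by (cases p) auto
    ultimately have "?lab x \<le> p * q" using c(2) by (metis add_mono atLeastAtMost_iff)
    then show "n \<in> {1..p * q}" using c(2) x(2) by simp
  qed
  moreover have "card (carrier N) = p * q"
    using G bij_betw_same_card[of _ "{1..p} \<times> {1..q}" "carrier N"]
    by (force simp: generating_matrix_def card_cartesian_product)
  ultimately show "labelling N (p * q) ?lab"
    unfolding labelling_def bij_betw_def
    by (simp add: card_image card_subset_eq)
qed

section \<open>Latin squares\<close>

text \<open>An injective map from \<open>m\<close> indices into \<open>m\<close> symbols is onto, so
  "each symbol exactly once" on a line amounts to "no symbol twice".\<close>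

lemma latin_square_iff_inj:
  fixes L :: "nat \<Rightarrow> nat \<Rightarrow> 'a"
  shows "latin_square m L \<longleftrightarrow>
     (\<exists>S. finite S \<and> card S = m \<and> (\<forall>i\<in>{1..m}. \<forall>j\<in>{1..m}. L i j \<in> S) \<and>
        (\<forall>i\<in>{1..m}. inj_on (\<lambda>j. L i j) {1..m}) \<and> (\<forall>j\<in>{1..m}. inj_on (\<lambda>i. L i j) {1..m}))"
proof -
  have line: "(\<forall>x\<in>S. \<exists>!j. j \<in> {1..m} \<and> h j = x) \<longleftrightarrow> inj_on h {1..m}"
    if "finite S" "card S = m" "h ` {1..m} \<subseteq> S" for S and h :: "nat \<Rightarrow> 'a"
  proof
    assume "\<forall>x\<in>S. \<exists>!j. j \<in> {1..m} \<and> h j = x"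
    then show "inj_on h {1..m}"
      using that(3) unfolding inj_on_def by blast
  next
    assume inj: "inj_on h {1..m}"
    then have img: "h ` {1..m} = S"
      using that by (intro card_subset_eq) (auto simp: card_image)
    show "\<forall>x\<in>S. \<exists>!j. j \<in> {1..m} \<and> h j = x"
    proof
      fix x assume "x \<in> S"
      then obtain j where "j \<in> {1..m}" "h j = x" unfolding img[symmetric] by (elim imageE) simp
      then show "\<exists>!j. j \<in> {1..m} \<and> h j = x"
        using inj by (intro ex1I[of _ j]) (simp, blast dest: inj_onD)
    qed
  qed
  have lines_iff: "(\<forall>x\<in>S. \<forall>i\<in>{1..m}. \<exists>!j. j \<in> {1..m} \<and> L i j = x) \<and>
        (\<forall>x\<in>S. \<forall>j\<in>{1..m}. \<exists>!i. i \<in> {1..m} \<and> L i j = x) \<longleftrightarrow>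
        (\<forall>i\<in>{1..m}. inj_on (\<lambda>j. L i j) {1..m}) \<and> (\<forall>j\<in>{1..m}. inj_on (\<lambda>i. L i j) {1..m})"
    if "finite S" "card S = m" "\<forall>i\<in>{1..m}. \<forall>j\<in>{1..m}. L i j \<in> S" for S
  proof -
    \<comment> \<open>The definition quantifies over symbols first and lines second, while
      \<open>line\<close> treats one line at a time; this exchanges the two.\<close>
    have swap: "(\<forall>x\<in>S. \<forall>i\<in>{1..m}. P i x) \<longleftrightarrow> (\<forall>i\<in>{1..m}. Q i)"
      if "\<And>i. i \<in> {1..m} \<Longrightarrow> (\<forall>x\<in>S. P i x) \<longleftrightarrow> Q i" for P and Q :: "nat \<Rightarrow> bool"
      using that by blast
    have lines: "(\<forall>x\<in>S. \<exists>!j. j \<in> {1..m} \<and> L i j = x) \<longleftrightarrow> inj_on (\<lambda>j. L i j) {1..m}"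
      "(\<forall>x\<in>S. \<exists>!j. j \<in> {1..m} \<and> L j i = x) \<longleftrightarrow> inj_on (\<lambda>j. L j i) {1..m}"
      if "i \<in> {1..m}" for i
      using that \<open>\<forall>i\<in>_. _\<close> by (intro line[OF \<open>finite S\<close> \<open>card S = m\<close>]; blast)+
    show ?thesis by (simp only: swap[OF lines(1)] swap[OF lines(2)])
  qed
  show ?thesis
    unfolding latin_square_def by (intro ex_cong1 conj_cong[OF refl]) (rule lines_iff)
qed

section \<open>Odd antilattices\<close>

lemma generating_pair_exists:
  assumes "antilattice N" "finite (carrier N)"
  shows "\<exists>p q M r s J. generating_pair N p q M r s J"
  using assms generating_matrix_exists
  unfolding antilattice_def generating_pair_def by metis

lemma pair_subantilattice_iff_collinear:
  assumes "generating_pair N p q M r s J" "x \<in> carrier N" "y \<in> carrier N"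
  shows "subantilattice N {x, y} \<longleftrightarrow> collinear p q M x y \<and> collinear r s J x y"
proof -
  have "subantilattice N {x, y} \<longleftrightarrow>
      (\<forall>u\<in>{x, y}. \<forall>v\<in>{x, y}. meet N u v \<in> {x, y}) \<and> (\<forall>u\<in>{x, y}. \<forall>v\<in>{x, y}. join N u v \<in> {x, y})"
    using assms by (auto simp: subantilattice_def)
  moreover have M: "generating_matrix (carrier N) (meet N) p q M"
    and J: "generating_matrix (carrier N) (join N) r s J"
    using assms(1) by (auto simp: generating_pair_def)
  ultimately show ?thesis
    by (simp only: pair_subband_iff_collinear[OF M assms(2,3)]
        pair_subband_iff_collinear[OF J assms(2,3)])
qed

lemma is_odd_iff_no_even_edge: "is_odd N \<longleftrightarrow> parcs (even_graph N) = {}"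
proof
  assume "is_odd N"
  then show "parcs (even_graph N) = {}"
    by (auto simp: is_odd_def even_graph_def card_2_iff)
next
  assume no: "parcs (even_graph N) = {}"
  show "is_odd N" unfolding is_odd_def
  proof
    assume "\<exists>S. subantilattice N S \<and> card S = 2"
    then obtain a b where "subantilattice N {a, b}" "a \<noteq> b" by (auto simp: card_2_iff)
    moreover from this have "a \<in> carrier N" "b \<in> carrier N" by (auto simp: subantilattice_def)
    ultimately show False using no by (auto simp: even_graph_def)
  qed
qed

text \<open>Oddness as an incidence condition, available for any choice of generating matrices; the
  later arguments on odd and Latin antilattices rest on it.\<close>

lemma is_odd_iff_collinear:
  assumes "generating_pair N p q M r s J"
  shows "is_odd N \<longleftrightarrow> (\<forall>x\<in>carrier N. \<forall>y\<in>carrier N.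
      collinear p q M x y \<and> collinear r s J x y \<longrightarrow> x = y)"
  using pair_subantilattice_iff_collinear[OF assms]
  by (auto simp: is_odd_iff_no_even_edge even_graph_def)

text \<open>The separation condition is symmetric in the two matrices, so the line lengths can be
  compared in both directions and all four coincide.\<close>

lemma odd_generating_pair_square:
  assumes "is_odd N" "generating_pair N p q M r s J"
  shows "q = p" "r = p" "s = p"
proof -
  have M: "generating_matrix (carrier N) (meet N) p q M"
    and J: "generating_matrix (carrier N) (join N) r s J"
    using assms(2) by (auto simp: generating_pair_def)
  have sep: "x = y" if "x \<in> carrier N" "y \<in> carrier N" "collinear p q M x y" "collinear r s J x y" for x y
    using assms is_odd_iff_collinear that by blast
  show "q = p" "r = p" "s = p"
    using matrix_lines_le[OF M J sep] matrix_lines_le[OF J M sep] by simp_all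
qed

section \<open>Equivalence of odd and Latin\<close>

lemma latin_imp_odd:
  assumes "is_latin N"
  shows "is_odd N"
proof -
  obtain p q m M J lab where gp: "generating_pair N p q M m m J"
    and nf: "normal_form p q (\<lambda>i j. lab (M i j))"
    and ols: "orthogonal_latin_squares m (\<lambda>i j. first_component q (lab (J i j)))
          (\<lambda>i j. second_component q (lab (J i j)))"
    using assms unfolding is_latin_def by blast
  have M: "generating_matrix (carrier N) (meet N) p q M"
    and J: "generating_matrix (carrier N) (join N) m m J"
    using gp by (auto simp: generating_pair_def)
  have inj: "inj_on (\<lambda>j. first_component q (lab (J i j))) {1..m}"
    "inj_on (\<lambda>j. second_component q (lab (J i j))) {1..m}"
    "inj_on (\<lambda>j. first_component q (lab (J j i))) {1..m}"
    "inj_on (\<lambda>j. second_component q (lab (J j i))) {1..m}" if "i \<in> {1..m}" for i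
    using ols that unfolding orthogonal_latin_squares_def latin_square_iff_inj by blast+
  show ?thesis unfolding is_odd_iff_collinear[OF gp]
  proof (intro ballI impI)
    fix x y assume x: "x \<in> carrier N" and y: "y \<in> carrier N"
      and col: "collinear p q M x y \<and> collinear m m J x y"
    note cx = matrix_coordinates[OF J x] and cy = matrix_coordinates[OF J y]
    let ?r = "row_of m m J" and ?c = "col_of m m J"
    \<comment> \<open>A common line of the meet matrix means a common symbol in one of the two Latin
      squares. If \<open>x\<close> and \<open>y\<close> also share a line of \<open>J\<close>, that
      symbol would be repeated on the line unless \<open>x = y\<close>.\<close>
    have eq: "first_component q (lab x) = first_component q (lab y) \<or>
        second_component q (lab x) = second_component q (lab y)"
      using col normal_form_components[OF M nf] x y by (auto simp: collinear_def)
    have "?r x = ?r y \<longrightarrow> ?c x = ?c y"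
      using eq inj(1,2)[OF cx(1)] cx cy by (metis inj_onD)
    moreover have "?c x = ?c y \<longrightarrow> ?r x = ?r y"
      using eq inj(3,4)[OF cx(2)] cx cy by (metis inj_onD)
    ultimately show "x = y" using col cx cy by (metis collinear_def)
  qed
qed

text \<open>Stated with explicit witnesses because both the Latin and the semimagic property are
  read off from them. The final range condition makes the components along a line of
  \<open>J\<close> permutations of \<open>{1..m}\<close>.\<close>

lemma odd_imp_square_latin_pair:
  assumes "antilattice N" "finite (carrier N)" "is_odd N"
  obtains m M J lab where "generating_pair N m m M m m J" "labelling N (m * m) lab"
    "normal_form m m (\<lambda>i j. lab (M i j))"
    "orthogonal_latin_squares m (\<lambda>i j. first_component m (lab (J i j)))
          (\<lambda>i j. second_component m (lab (J i j)))"
    "\<forall>x\<in>carrier N. first_component m (lab x) \<in> {1..m} \<and> second_component m (lab x) \<in> {1..m}"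
proof -
  obtain m M J where gp: "generating_pair N m m M m m J"
    using generating_pair_exists[OF assms(1,2)] odd_generating_pair_square[OF assms(3)] by metis
  have M: "generating_matrix (carrier N) (meet N) m m M"
    and J: "generating_matrix (carrier N) (join N) m m J"
    using gp by (auto simp: generating_pair_def)
  obtain lab where lab: "labelling N (m * m) lab" and nf: "normal_form m m (\<lambda>i j. lab (M i j))"
    using normal_form_labelling_exists[OF M] by blast
  note nc = normal_form_components[OF M nf]
  have range: "first_component m (lab x) \<in> {1..m}" "second_component m (lab x) \<in> {1..m}"
    if "x \<in> carrier N" for x
    using nc[OF that] matrix_coordinates[OF M that] by auto
  \<comment> \<open>One statement for all four injectivity claims: \<open>i = k\<close> treats rows
    and \<open>j = l\<close> columns of \<open>J\<close>, and the two disjuncts on labels treat the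
    two squares.\<close>
  have sep: "i = k \<and> j = l" if "i \<in> {1..m}" "j \<in> {1..m}" "k \<in> {1..m}" "l \<in> {1..m}"
    and "i = k \<or> j = l" and "first_component m (lab (J i j)) = first_component m (lab (J k l)) \<or>
      second_component m (lab (J i j)) = second_component m (lab (J k l))" for i j k l
  proof -
    note e = matrix_entry[OF J that(1,2)] and e' = matrix_entry[OF J that(3,4)]
    have "collinear m m M (J i j) (J k l)" "collinear m m J (J i j) (J k l)"
      using that e e' nc by (auto simp: collinear_def)
    then have "J i j = J k l"
      using assms(3) e e' unfolding is_odd_iff_collinear[OF gp] by blast
    then show ?thesis using e e' by auto
  qed
  have "latin_square m (\<lambda>i j. first_component m (lab (J i j)))"
    unfolding latin_square_iff_inj
  proof (intro exI[of _ "{1..m}"] conjI ballI inj_onI)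
    show "first_component m (lab (J i j)) \<in> {1..m}" if "i \<in> {1..m}" "j \<in> {1..m}" for i j
      using matrix_entry(1)[OF J that] range by blast
  qed (use sep in \<open>blast | simp\<close>)+
  moreover have "latin_square m (\<lambda>i j. second_component m (lab (J i j)))"
    unfolding latin_square_iff_inj
  proof (intro exI[of _ "{1..m}"] conjI ballI inj_onI)
    show "second_component m (lab (J i j)) \<in> {1..m}" if "i \<in> {1..m}" "j \<in> {1..m}" for i j
      using matrix_entry(1)[OF J that] range by blast
  qed (use sep in \<open>blast | simp\<close>)+
  \<comment> \<open>Orthogonality: the two components together are the full meet coordinates, which
    determine the element, and \<open>J\<close> contains each element once.\<close>
  moreover have "inj_on (\<lambda>(i, j). (first_component m (lab (J i j)), second_component m (lab (J i j))))
      ({1..m} \<times> {1..m})"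
  proof (rule inj_onI, clarify)
    fix i j k l
    assume ij: "i \<in> {1..m}" "j \<in> {1..m}" and kl: "k \<in> {1..m}" "l \<in> {1..m}"
      and eq: "first_component m (lab (J i j)) = first_component m (lab (J k l))"
      "second_component m (lab (J i j)) = second_component m (lab (J k l))"
    note e = matrix_entry[OF J ij] and e' = matrix_entry[OF J kl]
    have "J i j = J k l"
      using eq nc e(1) e'(1) matrix_coordinates(3)[OF M] by metis
    then show "i = k \<and> j = l" using e e' by auto
  qed
  ultimately show thesis
    using that[OF gp lab nf] range unfolding orthogonal_latin_squares_def by blast
qed

lemma odd_imp_latin:
  assumes "antilattice N" "finite (carrier N)" "is_odd N"
  shows "is_latin N"
  by (rule odd_imp_square_latin_pair[OF assms]) (unfold is_latin_def, intro exI conjI)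

section \<open>Semimagic squares\<close>

text \<open>Oddness is the convenient starting point: it supplies a square meet matrix, as the
  semimagic property demands, along with the Latin squares.\<close>

lemma odd_imp_semimagic:
  assumes "antilattice N" "finite (carrier N)" "is_odd N"
  shows "is_semimagic N"
proof -
  obtain m M J lab where gp: "generating_pair N m m M m m J" and lab: "labelling N (m * m) lab"
    and nf: "normal_form m m (\<lambda>i j. lab (M i j))"
    and ols: "orthogonal_latin_squares m (\<lambda>i j. first_component m (lab (J i j)))
          (\<lambda>i j. second_component m (lab (J i j)))"
    and range: "\<forall>x\<in>carrier N.
      first_component m (lab x) \<in> {1..m} \<and> second_component m (lab x) \<in> {1..m}"
    by (rule odd_imp_square_latin_pair[OF assms]) (rule that)
  have J: "bij_betw (\<lambda>(i, j). J i j) ({1..m} \<times> {1..m}) (carrier N)"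
    using gp by (auto simp: generating_pair_def generating_matrix_def)
  then have JN: "J i j \<in> carrier N" if "i \<in> {1..m}" "j \<in> {1..m}" for i j
    using that bij_betwE[OF J] by auto
  have lab_range: "lab x \<in> {1..m\<^sup>2}" if "x \<in> carrier N" for x
    using lab that by (auto simp: labelling_def bij_betw_def power2_eq_square)
  \<comment> \<open>Division with remainder applied to \<open>lab x - 1\<close>; labels start at 1,
    so the truncated subtraction is exact.\<close>
  have split: "lab x = (first_component m (lab x) - 1) * m + second_component m (lab x)"
    if "x \<in> carrier N" for x
    using lab_range[OF that] by (simp add: first_component_def second_component_def)
  \<comment> \<open>This is the usual magic constant \<open>m (m^2 + 1) / 2\<close>, left in the
    form in which the line sums arise.\<close>
  define c where "c = (\<Sum>k=1..m. (k - 1) * m) + (\<Sum>k=1..m. k)"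
  \<comment> \<open>Here \<open>h\<close> runs along a row or a column of \<open>J\<close>. Both
    components of its labels are injective self-maps of \<open>{1..m}\<close>, hence permutations,
    and each part of the sum can be reindexed.\<close>
  have line: "(\<Sum>j=1..m. lab (h j)) = c"
    if "\<And>j. j \<in> {1..m} \<Longrightarrow> h j \<in> carrier N" "inj_on (\<lambda>j. first_component m (lab (h j))) {1..m}"
      "inj_on (\<lambda>j. second_component m (lab (h j))) {1..m}" for h
  proof -
    have bij: "bij_betw (\<lambda>j. first_component m (lab (h j))) {1..m} {1..m}"
      "bij_betw (\<lambda>j. second_component m (lab (h j))) {1..m} {1..m}"
      using that range endo_inj_surj[of "{1..m}"] by (auto simp: bij_betw_def image_subset_iff)
    have "(\<Sum>j=1..m. lab (h j)) =
        (\<Sum>j=1..m. (first_component m (lab (h j)) - 1) * m + second_component m (lab (h j)))"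
      using split that(1) by (intro sum.cong) auto
    also have "\<dots> = c"
      using sum.reindex_bij_betw[OF bij(1), of "\<lambda>k. (k - 1) * m"]
        sum.reindex_bij_betw[OF bij(2), of "\<lambda>k. k"] by (simp add: sum.distrib c_def)
    finally show ?thesis .
  qed
  have inj: "inj_on (\<lambda>j. first_component m (lab (J i j))) {1..m}"
    "inj_on (\<lambda>j. second_component m (lab (J i j))) {1..m}"
    "inj_on (\<lambda>j. first_component m (lab (J j i))) {1..m}"
    "inj_on (\<lambda>j. second_component m (lab (J j i))) {1..m}" if "i \<in> {1..m}" for i
    using ols that unfolding orthogonal_latin_squares_def latin_square_iff_inj by blast+
  have "inj_on (lab \<circ> (\<lambda>(i, j). J i j)) ({1..m} \<times> {1..m})"
    by (rule bij_betw_imp_inj_on[OF bij_betw_trans[OF J lab[unfolded labelling_def]]])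
  then have "inj_on (\<lambda>(i, j). lab (J i j)) ({1..m} \<times> {1..m})"
    by (simp add: comp_def case_prod_unfold)
  moreover have "(\<Sum>j=1..m. lab (J i j)) = c" "(\<Sum>j=1..m. lab (J j i)) = c" if "i \<in> {1..m}" for i
    using line[of "\<lambda>j. J i j", OF JN[OF that] inj(1,2)[OF that]]
      line[of "\<lambda>j. J j i", OF JN[OF _ that] inj(3,4)[OF that]] by simp_all
  ultimately have "semimagic_square m (\<lambda>i j. lab (J i j))"
    unfolding semimagic_square_def using JN lab_range by blast
  then show ?thesis
    using gp lab nf unfolding is_semimagic_def power2_eq_square by blast
qed

section \<open>Congruences\<close>

text \<open>By idempotence \<open>x\<close> is its own meet and join with itself, so combining two
  elements related to \<open>x\<close> gives an element related to \<open>x\<close> again.\<close>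

lemma congruence_class_subantilattice:
  assumes N: "antilattice N" and R: "congruence N R" and x: "x \<in> carrier N"
  shows "subantilattice N (R `` {x})"
proof -
  have eq: "equiv (carrier N) R" using R by (simp add: congruence_def)
  have "meet N x x = x" "join N x x = x"
    using N x by (auto simp: antilattice_def rectangular_band_def)
  then have "(x, meet N a b) \<in> R \<and> (x, join N a b) \<in> R" if "(x, a) \<in> R" "(x, b) \<in> R" for a b
    using R that unfolding congruence_def by metis
  then show ?thesis
    using equiv_class_self[OF eq x] equiv_type[OF eq] by (auto simp: subantilattice_def)
qed

text \<open>Each class is a subantilattice, hence everything or a single point. One full class makes
  \<open>R\<close> universal; otherwise all classes are points and \<open>R\<close> is
  equality.\<close>

lemma elementary_imp_simple:
  assumes N: "antilattice N" and el: "is_elementary N"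
  shows "is_simple N"
  unfolding is_simple_def
proof (intro allI impI)
  fix R assume R: "congruence N R"
  have eq: "equiv (carrier N) R" using R by (simp add: congruence_def)
  have cases: "R `` {x} = carrier N \<or> R `` {x} = {x}" if "x \<in> carrier N" for x
  proof -
    have "R `` {x} = carrier N \<or> card (R `` {x}) = 1"
      using congruence_class_subantilattice[OF N R that] el by (auto simp: is_elementary_def)
    then show ?thesis using equiv_class_self[OF eq that] by (metis card_1_singletonE singletonD)
  qed
  show "R = Id_on (carrier N) \<or> R = carrier N \<times> carrier N"
  proof (cases "\<exists>x\<in>carrier N. R `` {x} = carrier N")
    case True
    then obtain x where "R `` {x} = carrier N" by blast
    then have "(a, b) \<in> R" if "a \<in> carrier N" "b \<in> carrier N" for a b
      using that eq by (metis Image_singleton_iff equivE symE transE)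
    then show ?thesis using equiv_type[OF eq] by auto
  next
    case False
    then have single: "R `` {x} = {x}" if "x \<in> carrier N" for x using cases that by blast
    have "R = (\<Union>x\<in>carrier N. {x} \<times> R `` {x})" using equiv_type[OF eq] by auto
    also have "\<dots> = (\<Union>x\<in>carrier N. {x} \<times> {x})" by (simp add: single)
    also have "\<dots> = Id_on (carrier N)" by (auto simp: Id_on_def)
    finally have "R = Id_on (carrier N)" .
    then show ?thesis by blast
  qed
qed

text \<open>A subantilattice of size 2 would be nontrivial, and proper by the cardinality
  assumption, which excludes the case where it is the whole carrier.\<close>

lemma elementary_imp_odd:
  assumes "is_elementary N" "card (carrier N) \<noteq> 2"
  shows "is_odd N"
  using assms unfolding is_elementary_def is_odd_def by (metis numeral_eq_one_iff semiring_norm(85))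

section \<open>Direct decompositions\<close>

text \<open>The kernel of the first projection is a congruence. It is not equality because the
  second factor has two elements, and not universal because the first has two.\<close>

lemma simple_imp_irreducible:
  assumes N: "antilattice N" and simple: "is_simple N"
  shows "is_irreducible N"
  unfolding is_irreducible_def
proof clarify
  fix A B :: "'a antilat"
  assume A: "more_than_one A" and B: "more_than_one B"
    and iso: "isomorphic N (direct_product A B)"
  obtain h where h: "bij_betw h (carrier N) (carrier A \<times> carrier B)"
    and hom: "\<And>x y. \<lbrakk>x \<in> carrier N; y \<in> carrier N\<rbrakk> \<Longrightarrow>
        h (meet N x y) = meet (direct_product A B) (h x) (h y) \<and>
        h (join N x y) = join (direct_product A B) (h x) (h y)"
    using iso by (auto simp: isomorphic_def direct_product_def)
  have cl: "meet N x y \<in> carrier N" "join N x y \<in> carrier N"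
    if "x \<in> carrier N" "y \<in> carrier N" for x y
    using N that by (auto simp: antilattice_def rectangular_band_def)
  define R where "R = {(x, y). x \<in> carrier N \<and> y \<in> carrier N \<and> fst (h x) = fst (h y)}"
  have "equiv (carrier N) R"
    by (auto simp: equiv_def R_def refl_on_def sym_def trans_def)
  moreover have "fst (h (meet N x y)) = meet A (fst (h x)) (fst (h y))"
    "fst (h (join N x y)) = join A (fst (h x)) (fst (h y))"
    if "x \<in> carrier N" "y \<in> carrier N" for x y
    using hom[OF that] by (auto simp: direct_product_def case_prod_unfold)
  ultimately have "congruence N R"
    using cl by (auto simp: congruence_def R_def)
  then have R: "R = Id_on (carrier N) \<or> R = carrier N \<times> carrier N"
    using simple by (simp add: is_simple_def)
  have ex: "\<exists>x\<in>carrier N. h x = (a, b)" if "a \<in> carrier A" "b \<in> carrier B" for a b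
    using h that by (force simp: bij_betw_def)
  obtain a a' b b' where ab: "a \<in> carrier A" "a' \<in> carrier A" "a \<noteq> a'"
    "b \<in> carrier B" "b' \<in> carrier B" "b \<noteq> b'"
    using A B by (auto simp: more_than_one_def)
  \<comment> \<open>The points \<open>x\<close> and \<open>y\<close> differ only in the second
    coordinate, \<open>x\<close> and \<open>z\<close> only in the first: the former pair refutes
    equality, the latter universality.\<close>
  obtain x y z where x: "x \<in> carrier N" "h x = (a, b)" and y: "y \<in> carrier N" "h y = (a, b')"
    and z: "z \<in> carrier N" "h z = (a', b)"
    using ex ab by metis
  have "(x, y) \<in> R" "(x, z) \<notin> R" "x \<noteq> y"
    using x y z ab by (auto simp: R_def)
  then show False using R x z by auto
qed

theorem theorem8p1:
  fixes N :: "'a antilat"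
  assumes "antilattice N" and "finite (carrier N)"
  shows "(is_elementary N \<longrightarrow> (card (carrier N) \<noteq> 2 \<longrightarrow> is_odd N) \<and> is_simple N) \<and>
    ((is_odd N \<and> is_simple N \<longrightarrow> is_odd N) \<and> (is_odd N \<and> is_simple N \<longrightarrow> is_simple N)) \<and>
    ((is_odd N \<longleftrightarrow> parcs (even_graph N) = {}) \<and> (parcs (even_graph N) = {} \<longleftrightarrow> is_latin N)) \<and>
    (is_latin N \<longrightarrow> is_semimagic N) \<and>
    (is_semimagic N \<longrightarrow> is_square N) \<and>
    (is_simple N \<longrightarrow> is_irreducible N)"
proof -
  \<comment> \<open>With this equivalence, Latin implies semimagic becomes the statement already
    proved for odd antilattices.\<close>
  have "is_odd N \<longleftrightarrow> is_latin N"
    using odd_imp_latin[OF assms] latin_imp_odd by blast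
  moreover have "is_semimagic N \<longrightarrow> is_square N"
    unfolding is_semimagic_def is_square_def by blast
  ultimately show ?thesis
    using elementary_imp_odd elementary_imp_simple[OF assms(1)] odd_imp_semimagic[OF assms]
      simple_imp_irreducible[OF assms(1)] is_odd_iff_no_even_edge[of N] by blast
qed

end
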